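(* Let $\Gamma$ be a set of formulas and let $\alpha,\beta,\gamma,t$ be formulas of the language $\mathbf L=\{\top,\sim,\wedge,\vee,\to\}$. In the logic $\mathcal{SN}$ (semi-intuitionistic logic with strong negation), with $\vdash$ denoting $\vdash_{\mathcal{SN}}$, the following properties hold: (a) If $\Gamma\vdash\alpha$ then $\Gamma\vdash\beta\to_N\alpha$. (b) $\Gamma\vdash\alpha\to_N\alpha$. (c) If $\Gamma\vdash\alpha\Rightarrow\beta$ then $\Gamma\vdash\alpha\to_N\beta$ and $\Gamma\vdash{\sim}\beta\to_N{\sim}\alpha$. (d) $\Gamma\vdash{\sim}\alpha\to_N{\sim}(\alpha\wedge\beta)$. (e) $\Gamma\vdash{\sim}\beta\to_N{\sim}(\alpha\wedge\beta)$. (f) $\Gamma,\ \alpha,\ \alpha\Rightarrow\beta\ \vdash\ \beta$. (g) If $\Gamma\vdash\alpha\Rightarrow\beta$ and $\Gamma\vdash\alpha$ then $\Gamma\vdash\beta$. (h) If $\Gamma\vdash\alpha$ and $\Gamma\vdash\beta$ then $\Gamma\vdash\alpha\wedge\beta$. (i) $\Gamma\vdash(\alpha\wedge\beta)\Rightarrow\alpha$ and $\Gamma\vdash(\alpha\wedge\beta)\Rightarrow\beta$. (j) $\Gamma\vdash\alpha\Rightarrow(\alpha\vee\beta)$ and $\Gamma\vdash\alpha\Rightarrow(\beta\vee\alpha)$. (k) $\Gamma\vdash\alpha\Rightarrow\alpha$. (l) If $\Gamma\vdash\alpha\Rightarrow\beta$ and $\Gamma\vdash\beta\Rightarrow\gamma$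 then $\Gamma\vdash\alpha\Rightarrow\gamma$. (m) $\Gamma,\ \alpha\Rightarrow\beta,\ \beta\Rightarrow\gamma\ \vdash\ \alpha\Rightarrow\gamma$. (n) If $\Gamma\vdash\alpha\to_N\beta$ then $\Gamma\vdash(\gamma\wedge\alpha)\to_N(\gamma\wedge\beta)$ and $\Gamma\vdash(\alpha\wedge\gamma)\to_N(\beta\wedge\gamma)$. (o) If $\Gamma\vdash\alpha\to_N\beta$ then $\Gamma\vdash(\gamma\vee\alpha)\to_N(\gamma\vee\beta)$ and $\Gamma\vdash(\alpha\vee\gamma)\to_N(\beta\vee\gamma)$. (p) $\Gamma\vdash(\alpha\vee\beta)\to_N(\beta\vee\alpha)$. (q) $\Gamma\vdash(\alpha\wedge\beta)\to_N(\beta\wedge\alpha)$. (r) $\Gamma,\ \alpha\Rightarrow\beta\ \vdash\ (\alpha\vee\gamma)\Rightarrow(\beta\vee\gamma)$. (s) $\Gamma,\ \alpha\Rightarrow\beta\ \vdash\ (\gamma\vee\alpha)\Rightarrow(\gamma\vee\beta)$. (t) $\Gamma,\ \alpha\Rightarrow\beta,\ \gamma\Rightarrow t\ \vdash\ (\alpha\vee\gamma)\Rightarrow(\beta\vee t)$. (u) $\Gamma,\ \beta\Rightarrow\alpha\ \vdash\ ({\sim}\alpha)\Rightarrow({\sim}\beta)$. (v) $\Gamma\vdash({\sim}(\alpha\to\beta))\to_N({\sim}(\alpha\to_N\beta))$.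
   Context: Formulas are built inductively from a countably infinite set of propositional variables using the connectives of $\mathbf L=\{\top,\sim,\wedge,\vee,\to\}$, where $\top$ is a constant, $\sim$ is unary, and $\wedge,\vee,\to$ are binary. The following are abbreviations: $\alpha\to_N\beta:=\alpha\to(\alpha\wedge\beta)$, and $\alpha\Rightarrow\beta:=(\alpha\to_N\beta)\wedge({\sim}\beta\to_N{\sim}\alpha)$. The logic $\mathcal{SN}$ (semi-intuitionistic logic with strong negation) is the Hilbert-style calculus with the following axiom schemata ($\alpha,\beta,\gamma$ arbitrary formulas): (A1) $(\alpha\to_N\beta)\to_N((\beta\to_N\gamma)\to_N(\alpha\to_N\gamma))$ (A2) $(\alpha\to_N\beta)\to_N((\alpha\to_N\gamma)\to_N(\alpha\to_N(\beta\wedge\gamma)))$ (A3) $(\alpha\wedge\beta)\to_N\alpha$ (A4) $(\alpha\wedge\beta)\to_N\beta$ (A5) $\alpha\to_N(\alpha\vee\beta)$ (A6) $\beta\to_N(\alpha\vee\beta)$ (A7) ${\sim}(\alpha\vee\beta)\to_N{\sim}\alpha$ (A8) ${\sim}(\alpha\vee\beta)\to_N{\sim}\beta$ (A9) $(\alpha\to_N\gamma)\to_N((\beta\to_N\gamma)\to_N((\alpha\vee\beta)\to_N\gamma))$ (A10) $({\sim}\alpha\to_N{\sim}\beta)\to_N(({\sim}\alpha\to_N{\sim}\gamma)\to_N({\sim}\alpha\to_N{\sim}(\beta\vee\gamma)))$ (A11) $\alpha\Rightarrow({\sim}{\sim}\alpha)$ (A12) $({\sim}{\sim}\alpha)\Rightarrow\alpha$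 (A13) $(\alpha\to_N\beta)\to_N[(\beta\to_N\alpha)\to_N[(\alpha\to\gamma)\to_N(\beta\to\gamma)]]$ (A14) $(\alpha\to_N\beta)\to_N[(\beta\to_N\alpha)\to_N[(\gamma\to\alpha)\to_N(\gamma\to\beta)]]$ (A15) $[(\alpha\wedge\beta)\to_N\gamma]\Rightarrow[\alpha\to_N(\beta\to_N\gamma)]$ (A16) $({\sim}(\alpha\wedge\beta))\Rightarrow({\sim}\alpha\vee{\sim}\beta)$ (A17) $({\sim}\alpha\vee{\sim}\beta)\Rightarrow({\sim}(\alpha\wedge\beta))$ (A18) $(\alpha\wedge({\sim}\alpha\vee\beta))\Rightarrow(\alpha\wedge(\alpha\to_N\beta))$ (A19) $(\alpha\to_N(\beta\to_N\gamma))\Rightarrow((\alpha\wedge\beta)\to_N\gamma)$ (A20) $({\sim}(\alpha\to\beta))\to_N(\alpha\wedge{\sim}\beta)$ (A21) $(\alpha\wedge{\sim}\beta)\to_N({\sim}(\alpha\to\beta))$ (A22) $[{\sim}(\alpha\wedge((\gamma\wedge\alpha)\vee(\beta\wedge\alpha)))]\to_N[{\sim}(\alpha\wedge(\beta\vee\gamma))]$ (A23) $\top$ The only inference rule is $\mathcal N$-Modus Ponens: from $\Gamma\vdash\phi$ and $\Gamma\vdash\phi\to_N\gamma$ infer $\Gamma\vdash\gamma$. Thus $\Gamma\vdash\phi$ (short for $\Gamma\vdash_{\mathcal{SN}}\phi$) means that there is a finite derivation of $\phi$ from instances of the axioms and elements of $\Gamma$ using $\mathcal N$-Modus Ponens.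 The notation $\Gamma,\phi_1,\dots,\phi_n\vdash\psi$ means $\Gamma\cup\{\phi_1,\dots,\phi_n\}\vdash\psi$. *)

theory Defs
  imports Main
begin

text \<open>
  The connectives are set in bold to keep them apart from those of HOL. The propositional
  variables are indexed by \<^typ>\<open>nat\<close>, i.e. there are countably infinitely many of them.
\<close>

datatype fm =
    Var nat
  | Top  (\<open>\<^bold>\<top>\<close>)
  | Neg fm  (\<open>\<^bold>\<sim> _\<close> [90] 90)
  | Conj fm fm  (infixr \<open>\<^bold>\<and>\<close> 85)
  | Disj fm fm  (infixr \<open>\<^bold>\<or>\<close> 80)
  | Imp fm fm  (infixr \<open>\<^bold>\<rightarrow>\<close> 75)

definition NImp :: "fm \<Rightarrow> fm \<Rightarrow> fm"  (infixr \<open>\<^bold>\<rightarrow>\<^sub>N\<close> 75) where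
  "\<alpha> \<^bold>\<rightarrow>\<^sub>N \<beta> = \<alpha> \<^bold>\<rightarrow> (\<alpha> \<^bold>\<and> \<beta>)"

definition SImp :: "fm \<Rightarrow> fm \<Rightarrow> fm"  (infixr \<open>\<^bold>\<Rightarrow>\<close> 70) where
  "\<alpha> \<^bold>\<Rightarrow> \<beta> = (\<alpha> \<^bold>\<rightarrow>\<^sub>N \<beta>) \<^bold>\<and> (\<^bold>\<sim> \<beta> \<^bold>\<rightarrow>\<^sub>N \<^bold>\<sim> \<alpha>)"

inductive SN_axiom :: "fm \<Rightarrow> bool" where
  A1: "SN_axiom ((\<alpha> \<^bold>\<rightarrow>\<^sub>N \<beta>) \<^bold>\<rightarrow>\<^sub>N ((\<beta> \<^bold>\<rightarrow>\<^sub>N \<gamma>) \<^bold>\<rightarrow>\<^sub>N (\<alpha> \<^bold>\<rightarrow>\<^sub>N \<gamma>)))"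
| A2: "SN_axiom ((\<alpha> \<^bold>\<rightarrow>\<^sub>N \<beta>) \<^bold>\<rightarrow>\<^sub>N ((\<alpha> \<^bold>\<rightarrow>\<^sub>N \<gamma>) \<^bold>\<rightarrow>\<^sub>N (\<alpha> \<^bold>\<rightarrow>\<^sub>N (\<beta> \<^bold>\<and> \<gamma>))))"
| A3: "SN_axiom ((\<alpha> \<^bold>\<and> \<beta>) \<^bold>\<rightarrow>\<^sub>N \<alpha>)"
| A4: "SN_axiom ((\<alpha> \<^bold>\<and> \<beta>) \<^bold>\<rightarrow>\<^sub>N \<beta>)"
| A5: "SN_axiom (\<alpha> \<^bold>\<rightarrow>\<^sub>N (\<alpha> \<^bold>\<or> \<beta>))"
| A6: "SN_axiom (\<beta> \<^bold>\<rightarrow>\<^sub>N (\<alpha> \<^bold>\<or> \<beta>))"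
| A7: "SN_axiom (\<^bold>\<sim> (\<alpha> \<^bold>\<or> \<beta>) \<^bold>\<rightarrow>\<^sub>N \<^bold>\<sim> \<alpha>)"
| A8: "SN_axiom (\<^bold>\<sim> (\<alpha> \<^bold>\<or> \<beta>) \<^bold>\<rightarrow>\<^sub>N \<^bold>\<sim> \<beta>)"
| A9: "SN_axiom ((\<alpha> \<^bold>\<rightarrow>\<^sub>N \<gamma>) \<^bold>\<rightarrow>\<^sub>N ((\<beta> \<^bold>\<rightarrow>\<^sub>N \<gamma>) \<^bold>\<rightarrow>\<^sub>N ((\<alpha> \<^bold>\<or> \<beta>) \<^bold>\<rightarrow>\<^sub>N \<gamma>)))"
| A10: "SN_axiom ((\<^bold>\<sim> \<alpha> \<^bold>\<rightarrow>\<^sub>N \<^bold>\<sim> \<beta>) \<^bold>\<rightarrow>\<^sub>N ((\<^bold>\<sim> \<alpha> \<^bold>\<rightarrow>\<^sub>N \<^bold>\<sim> \<gamma>) \<^bold>\<rightarrow>\<^sub>N (\<^bold>\<sim> \<alpha> \<^bold>\<rightarrow>\<^sub>N \<^bold>\<sim> (\<beta> \<^bold>\<or> \<gamma>))))"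
| A11: "SN_axiom (\<alpha> \<^bold>\<Rightarrow> (\<^bold>\<sim> (\<^bold>\<sim> \<alpha>)))"
| A12: "SN_axiom ((\<^bold>\<sim> (\<^bold>\<sim> \<alpha>)) \<^bold>\<Rightarrow> \<alpha>)"
| A13: "SN_axiom ((\<alpha> \<^bold>\<rightarrow>\<^sub>N \<beta>) \<^bold>\<rightarrow>\<^sub>N ((\<beta> \<^bold>\<rightarrow>\<^sub>N \<alpha>) \<^bold>\<rightarrow>\<^sub>N ((\<alpha> \<^bold>\<rightarrow> \<gamma>) \<^bold>\<rightarrow>\<^sub>N (\<beta> \<^bold>\<rightarrow> \<gamma>))))"
| A14: "SN_axiom ((\<alpha> \<^bold>\<rightarrow>\<^sub>N \<beta>) \<^bold>\<rightarrow>\<^sub>N ((\<beta> \<^bold>\<rightarrow>\<^sub>N \<alpha>) \<^bold>\<rightarrow>\<^sub>N ((\<gamma> \<^bold>\<rightarrow> \<alpha>) \<^bold>\<rightarrow>\<^sub>N (\<gamma> \<^bold>\<rightarrow> \<beta>))))"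
| A15: "SN_axiom (((\<alpha> \<^bold>\<and> \<beta>) \<^bold>\<rightarrow>\<^sub>N \<gamma>) \<^bold>\<Rightarrow> (\<alpha> \<^bold>\<rightarrow>\<^sub>N (\<beta> \<^bold>\<rightarrow>\<^sub>N \<gamma>)))"
| A16: "SN_axiom ((\<^bold>\<sim> (\<alpha> \<^bold>\<and> \<beta>)) \<^bold>\<Rightarrow> (\<^bold>\<sim> \<alpha> \<^bold>\<or> \<^bold>\<sim> \<beta>))"
| A17: "SN_axiom ((\<^bold>\<sim> \<alpha> \<^bold>\<or> \<^bold>\<sim> \<beta>) \<^bold>\<Rightarrow> (\<^bold>\<sim> (\<alpha> \<^bold>\<and> \<beta>)))"
| A18: "SN_axiom ((\<alpha> \<^bold>\<and> (\<^bold>\<sim> \<alpha> \<^bold>\<or> \<beta>)) \<^bold>\<Rightarrow> (\<alpha> \<^bold>\<and> (\<alpha> \<^bold>\<rightarrow>\<^sub>N \<beta>)))"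
| A19: "SN_axiom ((\<alpha> \<^bold>\<rightarrow>\<^sub>N (\<beta> \<^bold>\<rightarrow>\<^sub>N \<gamma>)) \<^bold>\<Rightarrow> ((\<alpha> \<^bold>\<and> \<beta>) \<^bold>\<rightarrow>\<^sub>N \<gamma>))"
| A20: "SN_axiom ((\<^bold>\<sim> (\<alpha> \<^bold>\<rightarrow> \<beta>)) \<^bold>\<rightarrow>\<^sub>N (\<alpha> \<^bold>\<and> \<^bold>\<sim> \<beta>))"
| A21: "SN_axiom ((\<alpha> \<^bold>\<and> \<^bold>\<sim> \<beta>) \<^bold>\<rightarrow>\<^sub>N (\<^bold>\<sim> (\<alpha> \<^bold>\<rightarrow> \<beta>)))"
| A22: "SN_axiom ((\<^bold>\<sim> (\<alpha> \<^bold>\<and> ((\<gamma> \<^bold>\<and> \<alpha>) \<^bold>\<or> (\<beta> \<^bold>\<and> \<alpha>)))) \<^bold>\<rightarrow>\<^sub>N (\<^bold>\<sim> (\<alpha> \<^bold>\<and> (\<beta> \<^bold>\<or> \<gamma>))))"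
| A23: "SN_axiom \<^bold>\<top>"

inductive SN_derives :: "fm set \<Rightarrow> fm \<Rightarrow> bool"  (infix \<open>\<turnstile>\<close> 50) for \<Gamma> :: "fm set" where
  ax: "SN_axiom \<phi> \<Longrightarrow> \<Gamma> \<turnstile> \<phi>"
| hyp: "\<phi> \<in> \<Gamma> \<Longrightarrow> \<Gamma> \<turnstile> \<phi>"
| NMP: "\<Gamma> \<turnstile> \<phi> \<Longrightarrow> \<Gamma> \<turnstile> \<phi> \<^bold>\<rightarrow>\<^sub>N \<gamma> \<Longrightarrow> \<Gamma> \<turnstile> \<gamma>"

end

theory Submission
  imports Defs
begin

text \<open>
  Each axiom whose main connective is \<open>\<^bold>\<rightarrow>\<^sub>N\<close> becomes a rule about \<open>\<turnstile>\<close> by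
  modus ponens, and with respect to these rules \<open>\<^bold>\<rightarrow>\<^sub>N\<close> behaves like a positive
  intuitionistic implication: A1 makes it transitive, A2 makes \<open>\<^bold>\<and>\<close> a meet and A9 makes \<open>\<^bold>\<or>\<close> a join.
  The rules hold over every set of hypotheses, so an item with extra formulas to the left of \<open>\<turnstile>\<close>
  is an instance of a rule over the enlarged set.

  Three facts are not among the axioms and start everything off. Detachment from \<open>\<^bold>\<Rightarrow>\<close> is just
  A3 and A4, since \<open>\<alpha> \<^bold>\<Rightarrow> \<beta>\<close> is a conjunction. Weakening, \<open>\<alpha> \<^bold>\<rightarrow>\<^sub>N (\<beta> \<^bold>\<rightarrow>\<^sub>N \<alpha>)\<close>, is A3 curried by A15.
  Reflexivity \<open>\<alpha> \<^bold>\<rightarrow>\<^sub>N \<alpha>\<close> is the round trip through \<open>\<^bold>\<sim> \<^bold>\<sim> \<alpha>\<close>. Weakening turns the meet rule into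
  closure of the theorems under \<open>\<^bold>\<and>\<close>, and so a claim about \<open>\<^bold>\<Rightarrow>\<close> splits into its two halves.

  For the contrapositive halves, the negated axioms play the dual part: by A7, A8 and A10 the formula
  \<open>\<^bold>\<sim> (\<alpha> \<^bold>\<or> \<beta>)\<close> is a meet of \<open>\<^bold>\<sim> \<alpha>\<close> and \<open>\<^bold>\<sim> \<beta>\<close> as far as negated formulas are concerned, and
  by A17 the formula \<open>\<^bold>\<sim> (\<alpha> \<^bold>\<and> \<beta>)\<close> lies above \<open>\<^bold>\<sim> \<alpha> \<^bold>\<or> \<^bold>\<sim> \<beta>\<close>.
\<close>

lemma NImp_trans:
  assumes "\<Gamma> \<turnstile> \<alpha> \<^bold>\<rightarrow>\<^sub>N \<beta>" and "\<Gamma> \<turnstile> \<beta> \<^bold>\<rightarrow>\<^sub>N \<gamma>"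
  shows "\<Gamma> \<turnstile> \<alpha> \<^bold>\<rightarrow>\<^sub>N \<gamma>"
  using assms by (meson A1 ax NMP)

lemma Conj_elim1: "\<Gamma> \<turnstile> \<alpha> \<^bold>\<and> \<beta> \<Longrightarrow> \<Gamma> \<turnstile> \<alpha>"
  by (meson A3 ax NMP)

lemma Conj_elim2: "\<Gamma> \<turnstile> \<alpha> \<^bold>\<and> \<beta> \<Longrightarrow> \<Gamma> \<turnstile> \<beta>"
  by (meson A4 ax NMP)

lemma SImp_imp_NImp: "\<Gamma> \<turnstile> \<alpha> \<^bold>\<Rightarrow> \<beta> \<Longrightarrow> \<Gamma> \<turnstile> \<alpha> \<^bold>\<rightarrow>\<^sub>N \<beta>"
  unfolding SImp_def by (rule Conj_elim1)

lemma SImp_imp_NImp_Neg: "\<Gamma> \<turnstile> \<alpha> \<^bold>\<Rightarrow> \<beta> \<Longrightarrow> \<Gamma> \<turnstile> \<^bold>\<sim> \<beta> \<^bold>\<rightarrow>\<^sub>N \<^bold>\<sim> \<alpha>"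
  unfolding SImp_def by (rule Conj_elim2)

lemma SImp_MP: "\<Gamma> \<turnstile> \<alpha> \<^bold>\<Rightarrow> \<beta> \<Longrightarrow> \<Gamma> \<turnstile> \<alpha> \<Longrightarrow> \<Gamma> \<turnstile> \<beta>"
  by (rule NMP[OF _ SImp_imp_NImp])

lemma NImp_refl: "\<Gamma> \<turnstile> \<alpha> \<^bold>\<rightarrow>\<^sub>N \<alpha>"
  by (rule NImp_trans[OF SImp_imp_NImp[OF ax[OF A11]] SImp_imp_NImp[OF ax[OF A12]]])

text \<open>
  A15 curries the projection \<open>(\<alpha> \<^bold>\<and> \<beta>) \<^bold>\<rightarrow>\<^sub>N \<alpha>\<close> into \<open>\<alpha> \<^bold>\<rightarrow>\<^sub>N (\<beta> \<^bold>\<rightarrow>\<^sub>N \<alpha>)\<close>.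
\<close>
lemma NImp_weaken:
  assumes "\<Gamma> \<turnstile> \<alpha>"
  shows "\<Gamma> \<turnstile> \<beta> \<^bold>\<rightarrow>\<^sub>N \<alpha>"
  by (rule NMP[OF assms SImp_MP[OF ax[OF A15] ax[OF A3]]])

lemma NImp_Conj_intro:
  assumes "\<Gamma> \<turnstile> \<alpha> \<^bold>\<rightarrow>\<^sub>N \<beta>" and "\<Gamma> \<turnstile> \<alpha> \<^bold>\<rightarrow>\<^sub>N \<gamma>"
  shows "\<Gamma> \<turnstile> \<alpha> \<^bold>\<rightarrow>\<^sub>N (\<beta> \<^bold>\<and> \<gamma>)"
  using assms by (meson A2 ax NMP)

text \<open>
  A2 introduces a conjunction only below an antecedent; \<open>\<alpha>\<close> itself serves as that antecedent and
  is then detached.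
\<close>
lemma Conj_intro:
  assumes "\<Gamma> \<turnstile> \<alpha>" and "\<Gamma> \<turnstile> \<beta>"
  shows "\<Gamma> \<turnstile> \<alpha> \<^bold>\<and> \<beta>"
  by (rule NMP[OF assms(1) NImp_Conj_intro[OF NImp_refl NImp_weaken[OF assms(2)]]])

lemma SImp_intro:
  "\<Gamma> \<turnstile> \<alpha> \<^bold>\<rightarrow>\<^sub>N \<beta> \<Longrightarrow> \<Gamma> \<turnstile> \<^bold>\<sim> \<beta> \<^bold>\<rightarrow>\<^sub>N \<^bold>\<sim> \<alpha> \<Longrightarrow> \<Gamma> \<turnstile> \<alpha> \<^bold>\<Rightarrow> \<beta>"
  unfolding SImp_def by (rule Conj_intro)

lemma SImp_trans:
  assumes "\<Gamma> \<turnstile> \<alpha> \<^bold>\<Rightarrow> \<beta>" and "\<Gamma> \<turnstile> \<beta> \<^bold>\<Rightarrow> \<gamma>"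
  shows "\<Gamma> \<turnstile> \<alpha> \<^bold>\<Rightarrow> \<gamma>"
  using assms by (meson SImp_intro SImp_imp_NImp SImp_imp_NImp_Neg NImp_trans)

lemma SImp_refl: "\<Gamma> \<turnstile> \<alpha> \<^bold>\<Rightarrow> \<alpha>"
  by (rule SImp_intro[OF NImp_refl NImp_refl])

lemma Neg_NImp_Neg_Conj1: "\<Gamma> \<turnstile> \<^bold>\<sim> \<alpha> \<^bold>\<rightarrow>\<^sub>N \<^bold>\<sim> (\<alpha> \<^bold>\<and> \<beta>)"
  by (rule NImp_trans[OF ax[OF A5] SImp_imp_NImp[OF ax[OF A17]]])

lemma Neg_NImp_Neg_Conj2: "\<Gamma> \<turnstile> \<^bold>\<sim> \<beta> \<^bold>\<rightarrow>\<^sub>N \<^bold>\<sim> (\<alpha> \<^bold>\<and> \<beta>)"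
  by (rule NImp_trans[OF ax[OF A6] SImp_imp_NImp[OF ax[OF A17]]])

lemma Conj_SImp1: "\<Gamma> \<turnstile> (\<alpha> \<^bold>\<and> \<beta>) \<^bold>\<Rightarrow> \<alpha>"
  by (rule SImp_intro[OF ax[OF A3] Neg_NImp_Neg_Conj1])

lemma Conj_SImp2: "\<Gamma> \<turnstile> (\<alpha> \<^bold>\<and> \<beta>) \<^bold>\<Rightarrow> \<beta>"
  by (rule SImp_intro[OF ax[OF A4] Neg_NImp_Neg_Conj2])

lemma SImp_Disj1: "\<Gamma> \<turnstile> \<alpha> \<^bold>\<Rightarrow> (\<alpha> \<^bold>\<or> \<beta>)"
  by (rule SImp_intro[OF ax[OF A5] ax[OF A7]])

lemma SImp_Disj2: "\<Gamma> \<turnstile> \<alpha> \<^bold>\<Rightarrow> (\<beta> \<^bold>\<or> \<alpha>)"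
  by (rule SImp_intro[OF ax[OF A6] ax[OF A8]])

lemma NImp_Conj_mono:
  assumes "\<Gamma> \<turnstile> \<alpha> \<^bold>\<rightarrow>\<^sub>N \<beta>" and "\<Gamma> \<turnstile> \<gamma> \<^bold>\<rightarrow>\<^sub>N \<delta>"
  shows "\<Gamma> \<turnstile> (\<alpha> \<^bold>\<and> \<gamma>) \<^bold>\<rightarrow>\<^sub>N (\<beta> \<^bold>\<and> \<delta>)"
  by (rule NImp_Conj_intro[OF NImp_trans[OF ax[OF A3] assms(1)] NImp_trans[OF ax[OF A4] assms(2)]])

lemma NImp_Disj_elim:
  assumes "\<Gamma> \<turnstile> \<alpha> \<^bold>\<rightarrow>\<^sub>N \<gamma>" and "\<Gamma> \<turnstile> \<beta> \<^bold>\<rightarrow>\<^sub>N \<gamma>"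
  shows "\<Gamma> \<turnstile> (\<alpha> \<^bold>\<or> \<beta>) \<^bold>\<rightarrow>\<^sub>N \<gamma>"
  using assms by (meson A9 ax NMP)

lemma NImp_Disj_mono:
  assumes "\<Gamma> \<turnstile> \<alpha> \<^bold>\<rightarrow>\<^sub>N \<beta>" and "\<Gamma> \<turnstile> \<gamma> \<^bold>\<rightarrow>\<^sub>N \<delta>"
  shows "\<Gamma> \<turnstile> (\<alpha> \<^bold>\<or> \<gamma>) \<^bold>\<rightarrow>\<^sub>N (\<beta> \<^bold>\<or> \<delta>)"
  by (rule NImp_Disj_elim[OF NImp_trans[OF assms(1) ax[OF A5]] NImp_trans[OF assms(2) ax[OF A6]]])

lemma Disj_NImp_commute: "\<Gamma> \<turnstile> (\<alpha> \<^bold>\<or> \<beta>) \<^bold>\<rightarrow>\<^sub>N (\<beta> \<^bold>\<or> \<alpha>)"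
  by (rule NImp_Disj_elim[OF ax[OF A6] ax[OF A5]])

lemma Conj_NImp_commute: "\<Gamma> \<turnstile> (\<alpha> \<^bold>\<and> \<beta>) \<^bold>\<rightarrow>\<^sub>N (\<beta> \<^bold>\<and> \<alpha>)"
  by (rule NImp_Conj_intro[OF ax[OF A4] ax[OF A3]])

lemma Neg_NImp_Neg_Disj_intro:
  assumes "\<Gamma> \<turnstile> \<^bold>\<sim> \<alpha> \<^bold>\<rightarrow>\<^sub>N \<^bold>\<sim> \<beta>" and "\<Gamma> \<turnstile> \<^bold>\<sim> \<alpha> \<^bold>\<rightarrow>\<^sub>N \<^bold>\<sim> \<gamma>"
  shows "\<Gamma> \<turnstile> \<^bold>\<sim> \<alpha> \<^bold>\<rightarrow>\<^sub>N \<^bold>\<sim> (\<beta> \<^bold>\<or> \<gamma>)"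
  using assms by (meson A10 ax NMP)

lemma SImp_Disj_mono:
  assumes "\<Gamma> \<turnstile> \<alpha> \<^bold>\<Rightarrow> \<beta>" and "\<Gamma> \<turnstile> \<gamma> \<^bold>\<Rightarrow> \<delta>"
  shows "\<Gamma> \<turnstile> (\<alpha> \<^bold>\<or> \<gamma>) \<^bold>\<Rightarrow> (\<beta> \<^bold>\<or> \<delta>)"
proof (rule SImp_intro)
  show "\<Gamma> \<turnstile> (\<alpha> \<^bold>\<or> \<gamma>) \<^bold>\<rightarrow>\<^sub>N (\<beta> \<^bold>\<or> \<delta>)"
    by (rule NImp_Disj_mono[OF assms[THEN SImp_imp_NImp]])
  show "\<Gamma> \<turnstile> \<^bold>\<sim> (\<beta> \<^bold>\<or> \<delta>) \<^bold>\<rightarrow>\<^sub>N \<^bold>\<sim> (\<alpha> \<^bold>\<or> \<gamma>)"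
    by (rule Neg_NImp_Neg_Disj_intro
        [OF NImp_trans[OF ax[OF A7] SImp_imp_NImp_Neg[OF assms(1)]]
            NImp_trans[OF ax[OF A8] SImp_imp_NImp_Neg[OF assms(2)]]])
qed

text \<open>
  The contrapositive half of the conclusion concerns double negations; they are removed by A12 and
  restored by A11, and in between \<open>\<beta> \<^bold>\<rightarrow>\<^sub>N \<alpha>\<close> applies.
\<close>
lemma SImp_contrapos:
  assumes "\<Gamma> \<turnstile> \<beta> \<^bold>\<Rightarrow> \<alpha>"
  shows "\<Gamma> \<turnstile> \<^bold>\<sim> \<alpha> \<^bold>\<Rightarrow> \<^bold>\<sim> \<beta>"
proof (rule SImp_intro[OF SImp_imp_NImp_Neg[OF assms]])
  show "\<Gamma> \<turnstile> \<^bold>\<sim> (\<^bold>\<sim> \<beta>) \<^bold>\<rightarrow>\<^sub>N \<^bold>\<sim> (\<^bold>\<sim> \<alpha>)"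
    by (rule NImp_trans[OF SImp_imp_NImp[OF ax[OF A12]]
          NImp_trans[OF SImp_imp_NImp[OF assms] SImp_imp_NImp[OF ax[OF A11]]]])
qed

text \<open>
  A negated implication \<open>\<^bold>\<sim> (\<alpha> \<^bold>\<rightarrow> \<beta>)\<close> is \<open>\<^bold>\<rightarrow>\<^sub>N\<close>-equivalent to \<open>\<alpha> \<^bold>\<and> \<^bold>\<sim> \<beta>\<close>, by A20 and A21. As \<open>\<alpha> \<^bold>\<rightarrow>\<^sub>N \<beta>\<close> stands for
  \<open>\<alpha> \<^bold>\<rightarrow> (\<alpha> \<^bold>\<and> \<beta>)\<close>, it suffices to pass from \<open>\<^bold>\<sim> \<beta>\<close> to \<open>\<^bold>\<sim> (\<alpha> \<^bold>\<and> \<beta>)\<close>.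
\<close>
lemma Neg_Imp_NImp_Neg_NImp: "\<Gamma> \<turnstile> \<^bold>\<sim> (\<alpha> \<^bold>\<rightarrow> \<beta>) \<^bold>\<rightarrow>\<^sub>N \<^bold>\<sim> (\<alpha> \<^bold>\<rightarrow>\<^sub>N \<beta>)"
proof -
  have "\<Gamma> \<turnstile> (\<alpha> \<^bold>\<and> \<^bold>\<sim> \<beta>) \<^bold>\<rightarrow>\<^sub>N (\<alpha> \<^bold>\<and> \<^bold>\<sim> (\<alpha> \<^bold>\<and> \<beta>))"
    by (rule NImp_Conj_mono[OF NImp_refl Neg_NImp_Neg_Conj2])
  then have "\<Gamma> \<turnstile> \<^bold>\<sim> (\<alpha> \<^bold>\<rightarrow> \<beta>) \<^bold>\<rightarrow>\<^sub>N \<^bold>\<sim> (\<alpha> \<^bold>\<rightarrow> (\<alpha> \<^bold>\<and> \<beta>))"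
    by (rule NImp_trans[OF ax[OF A20] NImp_trans[OF _ ax[OF A21]]])
  then show ?thesis
    by (simp only: NImp_def[of \<alpha> \<beta>])
qed

theorem lemma2p1:
  fixes \<Gamma> :: "fm set" and \<alpha> \<beta> \<gamma> t :: fm
  shows
    "(\<Gamma> \<turnstile> \<alpha> \<longrightarrow> \<Gamma> \<turnstile> \<beta> \<^bold>\<rightarrow>\<^sub>N \<alpha>) \<and>
     (\<Gamma> \<turnstile> \<alpha> \<^bold>\<rightarrow>\<^sub>N \<alpha>) \<and>
     (\<Gamma> \<turnstile> \<alpha> \<^bold>\<Rightarrow> \<beta> \<longrightarrow> \<Gamma> \<turnstile> \<alpha> \<^bold>\<rightarrow>\<^sub>N \<beta> \<and> \<Gamma> \<turnstile> \<^bold>\<sim> \<beta> \<^bold>\<rightarrow>\<^sub>N \<^bold>\<sim> \<alpha>) \<and>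
     (\<Gamma> \<turnstile> \<^bold>\<sim> \<alpha> \<^bold>\<rightarrow>\<^sub>N \<^bold>\<sim> (\<alpha> \<^bold>\<and> \<beta>)) \<and>
     (\<Gamma> \<turnstile> \<^bold>\<sim> \<beta> \<^bold>\<rightarrow>\<^sub>N \<^bold>\<sim> (\<alpha> \<^bold>\<and> \<beta>)) \<and>
     (\<Gamma> \<union> {\<alpha>, \<alpha> \<^bold>\<Rightarrow> \<beta>} \<turnstile> \<beta>) \<and>
     (\<Gamma> \<turnstile> \<alpha> \<^bold>\<Rightarrow> \<beta> \<and> \<Gamma> \<turnstile> \<alpha> \<longrightarrow> \<Gamma> \<turnstile> \<beta>) \<and>
     (\<Gamma> \<turnstile> \<alpha> \<and> \<Gamma> \<turnstile> \<beta> \<longrightarrow> \<Gamma> \<turnstile> \<alpha> \<^bold>\<and> \<beta>) \<and>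
     (\<Gamma> \<turnstile> (\<alpha> \<^bold>\<and> \<beta>) \<^bold>\<Rightarrow> \<alpha> \<and> \<Gamma> \<turnstile> (\<alpha> \<^bold>\<and> \<beta>) \<^bold>\<Rightarrow> \<beta>) \<and>
     (\<Gamma> \<turnstile> \<alpha> \<^bold>\<Rightarrow> (\<alpha> \<^bold>\<or> \<beta>) \<and> \<Gamma> \<turnstile> \<alpha> \<^bold>\<Rightarrow> (\<beta> \<^bold>\<or> \<alpha>)) \<and>
     (\<Gamma> \<turnstile> \<alpha> \<^bold>\<Rightarrow> \<alpha>) \<and>
     (\<Gamma> \<turnstile> \<alpha> \<^bold>\<Rightarrow> \<beta> \<and> \<Gamma> \<turnstile> \<beta> \<^bold>\<Rightarrow> \<gamma> \<longrightarrow> \<Gamma> \<turnstile> \<alpha> \<^bold>\<Rightarrow> \<gamma>) \<and>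
     (\<Gamma> \<union> {\<alpha> \<^bold>\<Rightarrow> \<beta>, \<beta> \<^bold>\<Rightarrow> \<gamma>} \<turnstile> \<alpha> \<^bold>\<Rightarrow> \<gamma>) \<and>
     (\<Gamma> \<turnstile> \<alpha> \<^bold>\<rightarrow>\<^sub>N \<beta> \<longrightarrow> \<Gamma> \<turnstile> (\<gamma> \<^bold>\<and> \<alpha>) \<^bold>\<rightarrow>\<^sub>N (\<gamma> \<^bold>\<and> \<beta>) \<and> \<Gamma> \<turnstile> (\<alpha> \<^bold>\<and> \<gamma>) \<^bold>\<rightarrow>\<^sub>N (\<beta> \<^bold>\<and> \<gamma>)) \<and>
     (\<Gamma> \<turnstile> \<alpha> \<^bold>\<rightarrow>\<^sub>N \<beta> \<longrightarrow> \<Gamma> \<turnstile> (\<gamma> \<^bold>\<or> \<alpha>) \<^bold>\<rightarrow>\<^sub>N (\<gamma> \<^bold>\<or> \<beta>) \<and> \<Gamma> \<turnstile> (\<alpha> \<^bold>\<or> \<gamma>) \<^bold>\<rightarrow>\<^sub>N (\<beta> \<^bold>\<or> \<gamma>)) \<and>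
     (\<Gamma> \<turnstile> (\<alpha> \<^bold>\<or> \<beta>) \<^bold>\<rightarrow>\<^sub>N (\<beta> \<^bold>\<or> \<alpha>)) \<and>
     (\<Gamma> \<turnstile> (\<alpha> \<^bold>\<and> \<beta>) \<^bold>\<rightarrow>\<^sub>N (\<beta> \<^bold>\<and> \<alpha>)) \<and>
     (\<Gamma> \<union> {\<alpha> \<^bold>\<Rightarrow> \<beta>} \<turnstile> (\<alpha> \<^bold>\<or> \<gamma>) \<^bold>\<Rightarrow> (\<beta> \<^bold>\<or> \<gamma>)) \<and>
     (\<Gamma> \<union> {\<alpha> \<^bold>\<Rightarrow> \<beta>} \<turnstile> (\<gamma> \<^bold>\<or> \<alpha>) \<^bold>\<Rightarrow> (\<gamma> \<^bold>\<or> \<beta>)) \<and>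
     (\<Gamma> \<union> {\<alpha> \<^bold>\<Rightarrow> \<beta>, \<gamma> \<^bold>\<Rightarrow> t} \<turnstile> (\<alpha> \<^bold>\<or> \<gamma>) \<^bold>\<Rightarrow> (\<beta> \<^bold>\<or> t)) \<and>
     (\<Gamma> \<union> {\<beta> \<^bold>\<Rightarrow> \<alpha>} \<turnstile> (\<^bold>\<sim> \<alpha>) \<^bold>\<Rightarrow> (\<^bold>\<sim> \<beta>)) \<and>
     (\<Gamma> \<turnstile> (\<^bold>\<sim> (\<alpha> \<^bold>\<rightarrow> \<beta>)) \<^bold>\<rightarrow>\<^sub>N (\<^bold>\<sim> (\<alpha> \<^bold>\<rightarrow>\<^sub>N \<beta>)))"
proof (intro conjI impI; (elim conjE)?)
  show "\<Gamma> \<union> {\<alpha>, \<alpha> \<^bold>\<Rightarrow> \<beta>} \<turnstile> \<beta>"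
    by (rule SImp_MP[of _ \<alpha>]; simp add: hyp)
  show "\<Gamma> \<union> {\<alpha> \<^bold>\<Rightarrow> \<beta>, \<beta> \<^bold>\<Rightarrow> \<gamma>} \<turnstile> \<alpha> \<^bold>\<Rightarrow> \<gamma>"
    by (rule SImp_trans[of _ _ \<beta>]; simp add: hyp)
  show "\<Gamma> \<union> {\<alpha> \<^bold>\<Rightarrow> \<beta>} \<turnstile> (\<alpha> \<^bold>\<or> \<gamma>) \<^bold>\<Rightarrow> (\<beta> \<^bold>\<or> \<gamma>)"
    by (rule SImp_Disj_mono[OF hyp SImp_refl]) simp
  show "\<Gamma> \<union> {\<alpha> \<^bold>\<Rightarrow> \<beta>} \<turnstile> (\<gamma> \<^bold>\<or> \<alpha>) \<^bold>\<Rightarrow> (\<gamma> \<^bold>\<or> \<beta>)"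
    by (rule SImp_Disj_mono[OF SImp_refl hyp]) simp
  show "\<Gamma> \<union> {\<alpha> \<^bold>\<Rightarrow> \<beta>, \<gamma> \<^bold>\<Rightarrow> t} \<turnstile> (\<alpha> \<^bold>\<or> \<gamma>) \<^bold>\<Rightarrow> (\<beta> \<^bold>\<or> t)"
    by (rule SImp_Disj_mono; simp add: hyp)
  show "\<Gamma> \<union> {\<beta> \<^bold>\<Rightarrow> \<alpha>} \<turnstile> (\<^bold>\<sim> \<alpha>) \<^bold>\<Rightarrow> (\<^bold>\<sim> \<beta>)"
    by (rule SImp_contrapos[OF hyp]) simp
qed (assumption | rule NImp_refl NImp_weaken SImp_imp_NImp SImp_imp_NImp_Neg
      Neg_NImp_Neg_Conj1 Neg_NImp_Neg_Conj2 Conj_intro Conj_SImp1 Conj_SImp2 SImp_Disj1 SImp_Disj2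
      SImp_refl NImp_Conj_mono NImp_Disj_mono Disj_NImp_commute Conj_NImp_commute
      Neg_Imp_NImp_Neg_NImp | erule SImp_MP SImp_trans)+

end
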